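(* Let $p$ be an odd prime with $p\equiv 3 \pmod 4$. Then $D_{Q_p,\mathbf 1}=5$.
   Context: For an odd prime $p$, $\mathbb Z_p=\mathbb Z/p\mathbb Z$, $U(p)$ is its group of units, and $Q_p=\{x^2:x\in U(p)\}$. A sequence of length $k$ in $\mathbb Z_p$ is an element of $\mathbb Z_p^k$. A sequence $(x_1,\ldots,x_k)$ in $\mathbb Z_p$ is called a $(Q_p,\mathbf 1)$-weighted zero-sum sequence if there exist $a_1,\ldots,a_k\in Q_p$ such that $a_1x_1+\cdots+a_kx_k=0$ and $a_1+\cdots+a_k=0$ in $\mathbb Z_p$. The constant $D_{Q_p,\mathbf 1}$ is the least positive integer $k$ such that every sequence in $\mathbb Z_p$ of length $k$ has a (non-empty) $(Q_p,\mathbf 1)$-weighted zero-sum subsequence (terms not necessarily consecutive). *)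

theory Defs
  imports "HOL-Number_Theory.Number_Theory" "HOL-Library.Sublist"
begin

abbreviation Zmod :: "nat \<Rightarrow> int ring"
  where "Zmod p \<equiv> residue_ring (int p)"

definition Qset :: "nat \<Rightarrow> int set"
  where "Qset p = {x [^]\<^bsub>Zmod p\<^esub> (2::nat) |x. x \<in> Units (Zmod p)}"

definition weighted_zero_sum :: "nat \<Rightarrow> int list \<Rightarrow> bool"
  where "weighted_zero_sum p xs \<longleftrightarrow>
    (\<exists>as. length as = length xs \<and> set as \<subseteq> Qset p \<and>
      (\<Oplus>\<^bsub>Zmod p\<^esub>i\<in>{..<length xs}. as ! i \<otimes>\<^bsub>Zmod p\<^esub> xs ! i) = \<zero>\<^bsub>Zmod p\<^esub> \<and>
      (\<Oplus>\<^bsub>Zmod p\<^esub>i\<in>{..<length xs}. as ! i) = \<zero>\<^bsub>Zmod p\<^esub>)"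

text \<open>The empty list satisfies \<open>weighted_zero_sum\<close> vacuously, so non-emptiness of the
  subsequence is required explicitly.\<close>

definition D_const :: "nat \<Rightarrow> nat"
  where "D_const p = (LEAST k. k > 0 \<and>
    (\<forall>xs. length xs = k \<and> set xs \<subseteq> carrier (Zmod p) \<longrightarrow>
      (\<exists>ys. subseq ys xs \<and> ys \<noteq> [] \<and> weighted_zero_sum p ys)))"

end

theory Submission
  imports Defs
begin

text \<open>
  Giving weight \<open>0\<close> to the discarded terms and weight \<open>y\<^sub>i\<^sup>2\<close> to the others, a weighted zero-sum
  subsequence of \<open>(x\<^sub>1, \<dots>, x\<^sub>5)\<close> is a nontrivial common zero mod \<open>p\<close> of the two quadratic forms
  \<open>\<Sum> y\<^sub>i\<^sup>2\<close> and \<open>\<Sum> x\<^sub>i y\<^sub>i\<^sup>2\<close>. Their total degree is \<open>4 < 5\<close>, so the Chevalley-Warning theorem provides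
  one. Conversely \<open>(0, 0, 1, 1)\<close> has no such subsequence, since a sum of one or two elements of
  \<open>Q\<^sub>p\<close> is nonzero when \<open>-1\<close> is not a square.
\<close>

subsection \<open>The Chevalley-Warning theorem\<close>

text \<open>Telescoping \<open>(y+1)\<^sup>e\<^sup>+\<^sup>1 - y\<^sup>e\<^sup>+\<^sup>1\<close> over a full period expresses \<open>(e+1)\<close> times the \<open>e\<close>-th power sum
  through lower ones. Note that \<open>0^0 = 1\<close> makes the case \<open>e = 0\<close> come out right.\<close>

lemma prime_dvd_power_sum:
  fixes p e :: nat
  assumes "prime p" and "e < p - 1"
  shows "int p dvd (\<Sum>y\<in>{0..<int p}. y ^ e)"
  using assms(2)
proof (induction e rule: less_induct)
  case (less e)
  define S where "S j = (\<Sum>y<p. int y ^ j)" for j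
  have S: "(\<Sum>y\<in>{0..<int p}. y ^ j) = S j" for j
    unfolding S_def
    by (rule sum.reindex_bij_witness[of _ int nat]) auto
  have "int p ^ Suc e = (\<Sum>y<p. int (Suc y) ^ Suc e - int y ^ Suc e)"
    by (subst sum_lessThan_telescope) simp
  also have "\<dots> = (\<Sum>y<p. \<Sum>j\<le>e. of_nat (Suc e choose j) * int y ^ j)"
  proof (rule sum.cong)
    fix y
    have "int (Suc y) ^ Suc e = (int y + 1) ^ Suc e" by (simp add: add.commute)
    also have "\<dots> = (\<Sum>j\<le>Suc e. of_nat (Suc e choose j) * int y ^ j)"
      by (subst binomial_ring) simp
    finally show "int (Suc y) ^ Suc e - int y ^ Suc e
        = (\<Sum>j\<le>e. of_nat (Suc e choose j) * int y ^ j)"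
      by (simp del: power_Suc binomial_Suc_Suc)
  qed simp
  also have "\<dots> = (\<Sum>j\<le>e. of_nat (Suc e choose j) * S j)"
    by (subst sum.swap) (simp add: S_def sum_distrib_left)
  also have "\<dots> = (\<Sum>j<e. of_nat (Suc e choose j) * S j) + int (Suc e) * S e"
    by (simp add: lessThan_Suc_atMost[symmetric] del: binomial_Suc_Suc)
  finally have eq: "int (Suc e) * S e
      = int p ^ Suc e - (\<Sum>j<e. of_nat (Suc e choose j) * S j)"
    by simp
  have "int p dvd (\<Sum>j<e. of_nat (Suc e choose j) * S j)"
    using less by (intro dvd_sum dvd_mult) (auto simp: S)
  then have "int p dvd int (Suc e) * S e"
    unfolding eq by (intro dvd_diff) auto
  \<comment> \<open>Here \<open>e < p - 1\<close> enters: \<open>0 < e + 1 < p\<close>, so the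
    factor \<open>e + 1\<close> can be cancelled modulo \<open>p\<close>.\<close>
  moreover have "\<not> int p dvd int (Suc e)"
    using less.prems by (auto simp del: of_nat_Suc dest!: dvd_imp_le)
  ultimately show ?case
    using assms(1) prime_dvd_mult_iff[of "int p"] S by auto
qed

text \<open>Polynomials over the integers in the variables \<open>I\<close> are encoded as the
  functions they induce, with \<open>d\<close> an upper bound on the total degree. The induction
  rule reduces any property that is stable under addition to a single monomial.\<close>

inductive polyfun_deg_le :: "'i set \<Rightarrow> nat \<Rightarrow> (('i \<Rightarrow> int) \<Rightarrow> int) \<Rightarrow> bool"
  for I d where
  monom: "sum e I \<le> d \<Longrightarrow> polyfun_deg_le I d (\<lambda>y. c * (\<Prod>i\<in>I. y i ^ e i))"
| add: "polyfun_deg_le I d F \<Longrightarrow> polyfun_deg_le I d G \<Longrightarrow> polyfun_deg_le I d (\<lambda>y. F y + G y)"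

lemma polyfun_deg_le_const: "polyfun_deg_le I d (\<lambda>y. c)"
  using polyfun_deg_le.monom[of "\<lambda>_. 0" I d c] by simp

lemma polyfun_deg_le_mult:
  assumes "polyfun_deg_le I d F" and "polyfun_deg_le I d' G"
  shows "polyfun_deg_le I (d + d') (\<lambda>y. F y * G y)"
  using assms(1)
proof induction
  case (monom e c)
  show ?case
    using assms(2)
  proof induction
    case (monom e' c')
    have "polyfun_deg_le I (d + d') (\<lambda>y. (c * c') * (\<Prod>i\<in>I. y i ^ (e i + e' i)))"
      using monom \<open>sum e I \<le> d\<close> by (intro polyfun_deg_le.monom) (simp add: sum.distrib)
    then show ?case
      by (simp add: power_add prod.distrib mult_ac)
  next
    case (add F G)
    then show ?case
      using polyfun_deg_le.add[OF add.IH] by (simp add: distrib_left)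
  qed
next
  case (add F G)
  then show ?case
    using polyfun_deg_le.add[OF add.IH] by (simp add: distrib_right)
qed

lemma polyfun_deg_le_power:
  "polyfun_deg_le I d F \<Longrightarrow> polyfun_deg_le I (d * k) (\<lambda>y. F y ^ k)"
  by (induction k) (auto intro: polyfun_deg_le_const polyfun_deg_le_mult)

lemma polyfun_deg_le_sum:
  assumes "finite A" and "\<And>a. a \<in> A \<Longrightarrow> polyfun_deg_le I d (F a)"
  shows "polyfun_deg_le I d (\<lambda>y. \<Sum>a\<in>A. F a y)"
  using assms by (induction A) (auto intro: polyfun_deg_le_const polyfun_deg_le.add)

lemma polyfun_deg_le_prod:
  assumes "finite J" and "\<And>j. j \<in> J \<Longrightarrow> polyfun_deg_le I (d j) (F j)"
  shows "polyfun_deg_le I (sum d J) (\<lambda>y. \<Prod>j\<in>J. F j y)"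
  using assms by (induction J) (auto intro: polyfun_deg_le_const polyfun_deg_le_mult)

lemma polyfun_deg_le_coord_power:
  assumes "finite I" and "i \<in> I"
  shows "polyfun_deg_le I k (\<lambda>y. c * y i ^ k)"
proof -
  have "polyfun_deg_le I k (\<lambda>y. c * (\<Prod>j\<in>I. y j ^ (if j = i then k else 0)))"
    using assms by (intro polyfun_deg_le.monom) simp
  moreover have "(\<Prod>j\<in>I. y j ^ (if j = i then k else 0)) = y i ^ k" for y :: "'a \<Rightarrow> int"
  proof -
    have "(\<Prod>j\<in>I. y j ^ (if j = i then k else 0)) = (\<Prod>j\<in>I. if j = i then y j ^ k else 1)"
      by (rule prod.cong) auto
    then show ?thesis using assms by simp
  qed
  ultimately show ?thesis by simp
qed

text \<open>For a monomial the sum over the box factors into one-variable power sums. The degree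
  bound forces some exponent below \<open>p - 1\<close>, and the corresponding factor is divisible
  by \<open>p\<close>.\<close>

lemma prime_dvd_sum_polyfun:
  fixes p :: nat
  assumes "prime p" and "finite I" and "polyfun_deg_le I d F" and "d < card I * (p - 1)"
  shows "int p dvd (\<Sum>y\<in>I \<rightarrow>\<^sub>E {0..<int p}. F y)"
  using assms(3)
proof induction
  case (monom e c)
  have "\<exists>i\<in>I. e i < p - 1"
  proof (rule ccontr)
    assume "\<not> ?thesis"
    then have "(\<Sum>i\<in>I. p - 1) \<le> sum e I" by (intro sum_mono) auto
    with monom assms(4) show False by simp
  qed
  then obtain i where "i \<in> I" "e i < p - 1" by blast
  then have "int p dvd (\<Prod>i\<in>I. \<Sum>y\<in>{0..<int p}. y ^ e i)"
    using assms(2) prime_dvd_power_sum[OF assms(1)] by (meson dvd_prodI dvd_trans)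
  also have "(\<Prod>i\<in>I. \<Sum>y\<in>{0..<int p}. y ^ e i)
      = (\<Sum>y\<in>I \<rightarrow>\<^sub>E {0..<int p}. \<Prod>i\<in>I. y i ^ e i)"
    using assms(2) by (intro prod_sum_PiE) auto
  finally show ?case
    by (simp add: sum_distrib_left[symmetric])
next
  case (add F G)
  then show ?case by (simp add: sum.distrib)
qed

lemma fermat_little_int:
  fixes p :: nat and a :: int
  assumes "prime p" and "\<not> int p dvd a"
  shows "[a ^ (p - 1) = 1] (mod int p)"
proof -
  have "coprime a (int p)"
    using assms prime_imp_coprime[of "int p" a] by (simp add: coprime_commute)
  moreover have "totient p = p - 1"
    using assms(1) by (rule totient_prime)
  ultimately show ?thesis
    using residues.euler_theorem[of "int p" a] assms(1) prime_gt_1_nat[OF assms(1)]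
    by (simp add: residues_def)
qed

text \<open>By Fermat, the product of the \<open>1 - F j y ^ (p - 1)\<close> is congruent to the
  indicator function of the common zeros. Its degree is at most
  \<open>sum d J * (p - 1) < card I * (p - 1)\<close>, so its sum over the box, which counts the
  zeros modulo \<open>p\<close>, vanishes modulo \<open>p\<close>.\<close>

theorem Chevalley_Warning:
  fixes p :: nat
  assumes p: "prime p" and fin: "finite I" "finite J"
    and F: "\<And>j. j \<in> J \<Longrightarrow> polyfun_deg_le I (d j) (F j)"
    and less: "sum d J < card I"
  shows "p dvd card {y \<in> I \<rightarrow>\<^sub>E {0..<int p}. \<forall>j\<in>J. int p dvd F j y}"
proof -
  let ?D = "I \<rightarrow>\<^sub>E {0..<int p}"
  let ?Z = "{y \<in> ?D. \<forall>j\<in>J. int p dvd F j y}"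
  \<comment> \<open>The difference is spelled as a sum so that \<open>polyfun_deg_le.add\<close>
    applies.\<close>
  let ?G = "\<lambda>y. \<Prod>j\<in>J. 1 + (-1) * F j y ^ (p - 1)"
  have p1: "p > 1" using p by (rule prime_gt_1_nat)
  have "polyfun_deg_le I (\<Sum>j\<in>J. d j * (p - 1)) ?G"
  proof (intro polyfun_deg_le_prod[OF fin(2)] polyfun_deg_le.add[OF polyfun_deg_le_const])
    fix j assume "j \<in> J"
    then show "polyfun_deg_le I (d j * (p - 1)) (\<lambda>y. (-1) * F j y ^ (p - 1))"
      using polyfun_deg_le_mult[OF polyfun_deg_le_const[of I 0 "-1"] polyfun_deg_le_power[OF F]]
      by simp
  qed
  moreover have "(\<Sum>j\<in>J. d j * (p - 1)) < card I * (p - 1)"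
    using less p1 by (simp flip: sum_distrib_right)
  ultimately have dvd: "int p dvd (\<Sum>y\<in>?D. ?G y)"
    by (rule prime_dvd_sum_polyfun[OF p fin(1)])
  have "[?G y = (if y \<in> ?Z then 1 else 0)] (mod int p)" if "y \<in> ?D" for y
  proof (cases "y \<in> ?Z")
    case True
    have "[?G y = (\<Prod>j\<in>J. 1)] (mod int p)"
    proof (rule cong_prod)
      fix j assume "j \<in> J"
      then have "int p dvd F j y ^ (p - 1)"
        using True p1 by (auto intro: dvd_trans[OF _ dvd_power])
      then show "[1 + (-1) * F j y ^ (p - 1) = 1] (mod int p)"
        by (simp add: cong_iff_dvd_diff)
    qed
    then show ?thesis using True by simp
  next
    case False
    with that obtain j where j: "j \<in> J" "\<not> int p dvd F j y" by blast
    then have "int p dvd 1 + (-1) * F j y ^ (p - 1)"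
      using fermat_little_int[OF p j(2)] by (simp add: cong_iff_dvd_diff dvd_diff_commute)
    then have "int p dvd ?G y" by (rule dvd_trans[OF _ dvd_prodI[OF fin(2) j(1)]])
    then show ?thesis unfolding if_not_P[OF False] by (simp add: cong_0_iff)
  qed
  then have "[(\<Sum>y\<in>?D. ?G y) = (\<Sum>y\<in>?D. if y \<in> ?Z then 1 else 0)] (mod int p)"
    by (rule cong_sum)
  also have "(\<Sum>y\<in>?D. if y \<in> ?Z then 1 else 0) = int (card ?Z)"
    using fin(1) by (subst sum.inter_filter[symmetric]) (auto simp: finite_PiE)
  finally show ?thesis
    using dvd by (simp add: cong_dvd_iff)
qed

subsection \<open>Quadratic weights\<close>

lemma finsum_residue_ring:
  fixes p :: nat
  assumes "p > 1" and "finite A" and "\<And>i. i \<in> A \<Longrightarrow> f i \<in> carrier (Zmod p)"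
  shows "(\<Oplus>\<^bsub>Zmod p\<^esub>i\<in>A. f i) = (\<Sum>i\<in>A. f i) mod int p"
proof -
  interpret R: residues "int p" "Zmod p"
    using assms(1) by unfold_locales simp_all
  show ?thesis
    using assms(2,3)
  proof (induction A)
    case (insert i A)
    then have "(\<Oplus>\<^bsub>Zmod p\<^esub>i\<in>insert i A. f i) = f i \<oplus>\<^bsub>Zmod p\<^esub> ((\<Sum>i\<in>A. f i) mod int p)"
      by (subst R.finsum_insert) auto
    then show ?case
      using insert by (simp add: R.res_add_eq mod_add_right_eq)
  qed (simp add: R.res_zero_eq)
qed

text \<open>Letting \<open>x\<close> be any integer prime to \<open>p\<close>, not only a reduced
  representative, makes membership easy to check for weights given as squares of integers.\<close>

lemma Qset_eq:
  fixes p :: nat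
  assumes "prime p"
  shows "Qset p = {x\<^sup>2 mod int p |x. \<not> int p dvd x}"
proof -
  interpret R: residues_prime p "Zmod p"
    using assms by unfold_locales simp_all
  have p1: "p > 1" using assms by (rule prime_gt_1_nat)
  have units: "Units (Zmod p) = {1..int p - 1}"
    using R.res_prime_units_eq p1 by (simp add: of_nat_diff)
  have sq: "x [^]\<^bsub>Zmod p\<^esub> (2::nat) = x\<^sup>2 mod int p" if "x \<in> {1..int p - 1}" for x
    using R.pow_cong[of x 2] that by simp
  show ?thesis
  proof (intro equalityI subsetI)
    fix a assume "a \<in> Qset p"
    then obtain x where x: "a = x [^]\<^bsub>Zmod p\<^esub> (2::nat)" "x \<in> {1..int p - 1}"
      unfolding Qset_def units by blast
    moreover have "\<not> int p dvd x" using x(2) by (auto dest: zdvd_imp_le)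
    ultimately show "a \<in> {x\<^sup>2 mod int p |x. \<not> int p dvd x}" using sq by blast
  next
    fix a assume "a \<in> {x\<^sup>2 mod int p |x. \<not> int p dvd x}"
    then obtain x where x: "a = x\<^sup>2 mod int p" "\<not> int p dvd x" by blast
    have "x mod int p \<noteq> 0" using x(2) by (simp add: dvd_eq_mod_eq_0)
    moreover have "0 \<le> x mod int p" "x mod int p < int p" using p1 by simp_all
    ultimately have *: "x mod int p \<in> {1..int p - 1}" by auto
    have "a = (x mod int p) [^]\<^bsub>Zmod p\<^esub> (2::nat)"
      unfolding sq[OF *] x(1) by (rule power_mod[symmetric])
    with * show "a \<in> Qset p"
      unfolding Qset_def units by blast
  qed
qed

lemma Qset_subset_carrier: "prime p \<Longrightarrow> Qset p \<subseteq> carrier (Zmod p)"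
  by (auto simp: Qset_eq residue_ring_def prime_gt_0_nat)

text \<open>Passes from ring sums to divisibility of integer sums, the language of the
  Chevalley-Warning theorem above.\<close>

lemma weighted_zero_sum_iff:
  fixes p :: nat
  assumes "prime p" and "set xs \<subseteq> carrier (Zmod p)"
  shows "weighted_zero_sum p xs \<longleftrightarrow>
    (\<exists>as. length as = length xs \<and> set as \<subseteq> Qset p \<and>
      int p dvd (\<Sum>i<length xs. as ! i * xs ! i) \<and> int p dvd (\<Sum>i<length xs. as ! i))"
proof -
  have p1: "p > 1" using assms(1) by (rule prime_gt_1_nat)
  interpret R: residues "int p" "Zmod p"
    using p1 by unfold_locales simp_all
  have *: "(\<Oplus>\<^bsub>Zmod p\<^esub>i\<in>{..<length xs}. as ! i \<otimes>\<^bsub>Zmod p\<^esub> xs ! i) = \<zero>\<^bsub>Zmod p\<^esub>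
        \<longleftrightarrow> int p dvd (\<Sum>i<length xs. as ! i * xs ! i)"
      "(\<Oplus>\<^bsub>Zmod p\<^esub>i\<in>{..<length xs}. as ! i) = \<zero>\<^bsub>Zmod p\<^esub> \<longleftrightarrow> int p dvd (\<Sum>i<length xs. as ! i)"
    if "length as = length xs" "set as \<subseteq> Qset p" for as
  proof -
    have as: "as ! i \<in> carrier (Zmod p)" if "i < length xs" for i
      using that \<open>length as = length xs\<close> \<open>set as \<subseteq> Qset p\<close> Qset_subset_carrier[OF assms(1)]
      by (metis nth_mem subsetD)
    have xs: "xs ! i \<in> carrier (Zmod p)" if "i < length xs" for i
      using that assms(2) by auto
    show "(\<Oplus>\<^bsub>Zmod p\<^esub>i\<in>{..<length xs}. as ! i) = \<zero>\<^bsub>Zmod p\<^esub> \<longleftrightarrow> int p dvd (\<Sum>i<length xs. as ! i)"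
      using as p1 by (subst finsum_residue_ring) (auto simp: R.res_zero_eq dvd_eq_mod_eq_0)
    show "(\<Oplus>\<^bsub>Zmod p\<^esub>i\<in>{..<length xs}. as ! i \<otimes>\<^bsub>Zmod p\<^esub> xs ! i) = \<zero>\<^bsub>Zmod p\<^esub>
        \<longleftrightarrow> int p dvd (\<Sum>i<length xs. as ! i * xs ! i)"
      using as xs p1
      by (subst finsum_residue_ring) (auto simp: R.res_zero_eq R.res_mult_eq dvd_eq_mod_eq_0 mod_sum_eq)
  qed
  show ?thesis
    unfolding weighted_zero_sum_def using * by (intro ex_cong1) blast
qed

section \<open>Upper bound: common zeros of two diagonal quadratic forms\<close>

lemma exists_weighted_zero_sum_subseq:
  fixes p :: nat
  assumes "prime p" and "length xs \<ge> 5" and "set xs \<subseteq> carrier (Zmod p)"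
  shows "\<exists>ys. subseq ys xs \<and> ys \<noteq> [] \<and> weighted_zero_sum p ys"
proof -
  define I where "I = {..<length xs}"
  \<comment> \<open>\<open>F True\<close> yields the weighted sum of the terms,
    \<open>F False\<close> the sum of the weights.\<close>
  define F :: "bool \<Rightarrow> (nat \<Rightarrow> int) \<Rightarrow> int"
    where "F b y = (\<Sum>i\<in>I. (if b then xs ! i else 1) * y i ^ 2)" for b y
  define Z where "Z = {y \<in> I \<rightarrow>\<^sub>E {0..<int p}. \<forall>b\<in>UNIV. int p dvd F b y}"
  \<comment> \<open>The trivial zero; \<open>restrict\<close> makes it extensional, as elements of
    \<open>\<rightarrow>\<^sub>E\<close> must be.\<close>
  define z where "z = restrict (\<lambda>_. 0 :: int) I"
  have p1: "p > 1" using assms(1) by (rule prime_gt_1_nat)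
  have finI: "finite I" by (simp add: I_def)
  have "polyfun_deg_le I 2 (F b)" for b
    unfolding F_def by (intro polyfun_deg_le_sum polyfun_deg_le_coord_power finI)
  then have "p dvd card Z"
    unfolding Z_def using assms(1,2) finI
    by (intro Chevalley_Warning[where d = "\<lambda>_. 2"]) (simp_all add: I_def UNIV_bool)
  moreover have "z \<in> Z"
    using p1 by (auto simp: Z_def F_def z_def)
  moreover have "finite Z"
    unfolding Z_def using finI by (simp add: finite_PiE)
  \<comment> \<open>As \<open>z\<close> lies in \<open>Z\<close>, the cardinality is positive and
    divisible by \<open>p\<close>, hence at least \<open>p > 1\<close>.\<close>
  ultimately have "\<not> Z \<subseteq> {z}"
    using p1 card_mono[of "{z}" Z] by (auto simp: card_gt_0_iff dest!: dvd_imp_le)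
  then obtain y where y: "y \<in> Z" "y \<noteq> z" by auto
  have yI: "y \<in> I \<rightarrow>\<^sub>E {0..<int p}" using y(1) by (simp add: Z_def)
  have "\<exists>i\<in>I. y i \<noteq> 0"
  proof (rule ccontr)
    assume "\<not> ?thesis"
    then have "y = z" using yI p1 by (intro PiE_ext[of y I "\<lambda>_. {0..<int p}" z]) (auto simp: z_def)
    with y(2) show False by simp
  qed
  \<comment> \<open>The support of \<open>y\<close> in increasing order: the positions of the terms
    that are kept.\<close>
  define js where "js = filter (\<lambda>i. y i \<noteq> 0) [0..<length xs]"
  \<comment> \<open>Positions outside the support contribute \<open>0\<close>, so both forms at
    \<open>y\<close> can be read as sums over the kept terms.\<close>
  have sum_js: "(\<Sum>k<length js. (y (js ! k))\<^sup>2 * g (js ! k)) = (\<Sum>i\<in>I. g i * (y i)\<^sup>2)"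
    for g :: "nat \<Rightarrow> int"
  proof -
    have "distinct js" by (simp add: js_def)
    then have "(\<Sum>k<length js. (y (js ! k))\<^sup>2 * g (js ! k)) = (\<Sum>i\<in>set js. (y i)\<^sup>2 * g i)"
      by (intro sum.reindex_bij_betw bij_betw_nth) auto
    also have "\<dots> = (\<Sum>i\<in>I. g i * (y i)\<^sup>2)"
      using finI by (intro sum.mono_neutral_cong_left) (auto simp: js_def I_def)
    finally show ?thesis .
  qed
  define ys where "ys = map ((!) xs) js"
  define as where "as = map (\<lambda>i. (y i)\<^sup>2 mod int p) js"
  have "subseq ys (map ((!) xs) [0..<length xs])"
    unfolding ys_def js_def by (intro subseq_map subseq_filter_left)
  then have "subseq ys xs" by (simp add: map_nth)
  moreover have "ys \<noteq> []"
    using \<open>\<exists>i\<in>I. y i \<noteq> 0\<close> by (auto simp: ys_def js_def I_def filter_empty_conv)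
  moreover have "weighted_zero_sum p ys"
  proof (subst weighted_zero_sum_iff)
    show "set ys \<subseteq> carrier (Zmod p)"
      using assms(3) by (auto simp: ys_def js_def)
    \<comment> \<open>A nonzero coordinate lies strictly between \<open>0\<close> and
      \<open>p\<close>, so its square modulo \<open>p\<close> is an admissible weight.\<close>
    have "\<not> int p dvd y i" if "i \<in> set js" for i
      using that PiE_mem[OF yI, of i] by (auto simp: js_def I_def dest: zdvd_imp_le)
    then have "set as \<subseteq> Qset p"
      by (auto simp: as_def Qset_eq[OF assms(1)])
    moreover have "int p dvd (\<Sum>k<length ys. as ! k * ys ! k)"
    proof -
      have "[(\<Sum>k<length ys. as ! k * ys ! k)
          = (\<Sum>k<length js. (y (js ! k))\<^sup>2 * xs ! (js ! k))] (mod int p)"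
        unfolding ys_def length_map
        by (intro cong_sum) (simp add: as_def cong_def mod_mult_left_eq)
      then show ?thesis
        using y(1) sum_js[of "(!) xs"] by (auto simp: Z_def F_def UNIV_bool cong_dvd_iff)
    qed
    moreover have "int p dvd (\<Sum>k<length ys. as ! k)"
    proof -
      have "[(\<Sum>k<length ys. as ! k) = (\<Sum>k<length js. (y (js ! k))\<^sup>2 * 1)] (mod int p)"
        unfolding ys_def length_map by (intro cong_sum) (auto simp: as_def)
      then show ?thesis
        using y(1) sum_js[of "\<lambda>_. 1"] by (auto simp: Z_def F_def UNIV_bool cong_dvd_iff)
    qed
    ultimately show "\<exists>as. length as = length ys \<and> set as \<subseteq> Qset p \<and>
        int p dvd (\<Sum>k<length ys. as ! k * ys ! k) \<and> int p dvd (\<Sum>k<length ys. as ! k)"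
      by (intro exI[of _ as]) (simp add: as_def ys_def)
  qed (use assms in simp)
  ultimately show ?thesis by blast
qed

section \<open>Lower bound: non-residuosity of \<open>-1\<close> and the sequence (0, 0, 1,
  1)\<close>

text \<open>Raising \<open>u^2 = -v^2\<close> to the power \<open>(p - 1) / 2\<close>, which is odd
  for \<open>p = 4 * n + 3\<close>, gives \<open>1 = -1\<close> modulo \<open>p\<close> by Fermat,
  so \<open>p\<close> would divide \<open>2\<close>.\<close>

lemma not_prime_dvd_sum_two_squares:
  fixes p :: nat and u v :: int
  assumes "prime p" and "[p = 3] (mod 4)" and "\<not> int p dvd u" and "\<not> int p dvd v"
  shows "\<not> int p dvd u\<^sup>2 + v\<^sup>2"
proof
  assume "int p dvd u\<^sup>2 + v\<^sup>2"
  define n where "n = p div 4"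
  have p4: "p = 4 * n + 3"
    using assms(2) mult_div_mod_eq[of 4 p] by (simp add: cong_def n_def)
  have sq: "(w\<^sup>2) ^ (2 * n + 1) = w ^ (p - 1)" for w :: int
    by (simp add: p4 power_mult[symmetric] algebra_simps flip: power_Suc power_add)
  have "[u\<^sup>2 = - (v\<^sup>2)] (mod int p)"
    using \<open>int p dvd u\<^sup>2 + v\<^sup>2\<close> by (simp add: cong_iff_dvd_diff)
  then have "[(u\<^sup>2) ^ (2 * n + 1) = (- (v\<^sup>2)) ^ (2 * n + 1)] (mod int p)"
    by (rule cong_pow)
  then have "[u ^ (p - 1) = - (v ^ (p - 1))] (mod int p)"
    using sq by (simp only: power_minus_odd odd_even_add odd_one even_mult_iff) simp
  moreover have "[- (v ^ (p - 1)) = - 1] (mod int p)"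
    using fermat_little_int[OF assms(1,4)] by (simp add: cong_minus_minus_iff)
  ultimately have "[1 = - 1] (mod int p)"
    using fermat_little_int[OF assms(1,3)] by (metis cong_sym cong_trans)
  then have "int p dvd 2" by (simp add: cong_iff_dvd_diff)
  then show False using p4 by (auto dest: zdvd_imp_le)
qed

text \<open>If a 1 is kept, the weighted sum is a sum of one or two weights; if only zeros are kept,
  the sum of the weights itself is such a sum.\<close>

lemma not_weighted_zero_sum_0011:
  fixes p :: nat
  assumes "prime p" and "[p = 3] (mod 4)" and "subseq ys [0, 0, 1, 1]" and "ys \<noteq> []"
  shows "\<not> weighted_zero_sum p ys"
proof -
  have p1: "p > 1" using assms(1) by (rule prime_gt_1_nat)
  have Q1: "\<not> int p dvd a" if "a \<in> Qset p" for a
    using that assms(1) by (auto simp: Qset_eq dvd_mod_iff prime_dvd_power_iff)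
  have Q2: "\<not> int p dvd a + b" if "a \<in> Qset p" "b \<in> Qset p" for a b
  proof -
    from that obtain u v
      where "a = u\<^sup>2 mod int p" "b = v\<^sup>2 mod int p" "\<not> int p dvd u" "\<not> int p dvd v"
      unfolding Qset_eq[OF assms(1)] by blast
    with not_prime_dvd_sum_two_squares[OF assms(1,2), of u v] show ?thesis
      by (simp add: dvd_eq_mod_eq_0 mod_add_eq)
  qed
  \<comment> \<open>Membership in an explicit finite list lets \<open>auto\<close> run through all
    the subsequences.\<close>
  have ys: "ys \<in> set (subseqs [0, 0, 1, 1])"
    using assms(3) by (simp only: set_subseqs_eq mem_Collect_eq)
  have "\<not> (int p dvd (\<Sum>i<length ys. as ! i * ys ! i) \<and> int p dvd (\<Sum>i<length ys. as ! i))"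
    if "length as = length ys" "set as \<subseteq> Qset p" for as
  proof -
    have "as ! i \<in> Qset p" if "i < length ys" for i
      using that \<open>length as = length ys\<close> \<open>set as \<subseteq> Qset p\<close> by (metis nth_mem subsetD)
    then show ?thesis
      using ys assms(4) by (auto simp: Let_def Q1 Q2 numeral_eq_Suc)
  qed
  moreover have "set ys \<subseteq> carrier (Zmod p)"
    using ys p1 by (auto simp: Let_def residue_ring_def)
  ultimately show ?thesis
    using weighted_zero_sum_iff[OF assms(1)] by blast
qed

theorem theorem4p3:
  fixes p :: nat
  assumes "prime p" and "odd p" and "[p = 3] (mod 4)"
  shows "D_const p = 5"
  unfolding D_const_def
proof (rule Least_equality)
  show "0 < (5::nat) \<and> (\<forall>xs. length xs = 5 \<and> set xs \<subseteq> carrier (Zmod p) \<longrightarrow>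
      (\<exists>ys. subseq ys xs \<and> ys \<noteq> [] \<and> weighted_zero_sum p ys))"
    using exists_weighted_zero_sum_subseq[OF assms(1)] by simp
next
  fix k :: nat
  assume k: "0 < k \<and> (\<forall>xs. length xs = k \<and> set xs \<subseteq> carrier (Zmod p) \<longrightarrow>
      (\<exists>ys. subseq ys xs \<and> ys \<noteq> [] \<and> weighted_zero_sum p ys))"
  show "5 \<le> k"
  proof (rule ccontr)
    assume "\<not> 5 \<le> k"
    \<comment> \<open>A prefix of length \<open>k\<close> treats every \<open>k\<close> below 5 at
      once, since its subsequences are also subsequences of the full list.\<close>
    let ?xs = "take k [0, 0, 1, 1 :: int]"
    have "length ?xs = k" using \<open>\<not> 5 \<le> k\<close> by simp
    moreover have "set ?xs \<subseteq> carrier (Zmod p)"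
      using set_take_subset[of k "[0, 0, 1, 1 :: int]"] prime_gt_1_nat[OF assms(1)]
      by (auto simp: residue_ring_def)
    ultimately obtain ys where "subseq ys ?xs" "ys \<noteq> []" "weighted_zero_sum p ys"
      using k by blast
    moreover have "subseq ?xs [0, 0, 1, 1]"
      by (metis append_take_drop_id list_emb_append2 prefix_def prefix_imp_subseq)
    ultimately show False
      using not_weighted_zero_sum_0011[OF assms(1,3)] subseq_order.trans by blast
  qed
qed

end
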